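(* Let $F$ be a field, $m\ge 1$, $I=\{1,\dots,m\}$, and let $a,b\in\mathcal O_m$ be associative binary operations on $I$. If $a\sim b$, i.e. there exists a permutation $\pi\in S_m$ such that $$a(j,n)=\pi^{-1}\big(b(\pi(j),\pi(n))\big)\qquad\text{for all } j,n\in I,$$ then the algebras $\mathfrak C_a$ and $\mathfrak C_b$ of cubic matrices over $F$ are isomorphic (as $F$-algebras).
   Context: Algebras need not be unital or commutative: an algebra over $F$ is a vector space with a bilinear multiplication; homomorphisms are linear multiplicative maps, and isomorphisms are bijective homomorphisms. $\mathcal O_m$ denotes the set of all associative binary operations $a\colon I\times I\to I$. $S_m$ is the group of permutations of $I$; it acts on $\mathcal O_m$ by $(\pi a)(i,j)=\pi\big(a(\pi^{-1}(i),\pi^{-1}(j))\big)$, and $a\sim b$ means that $a$ and $b$ lie in the same $S_m$-orbit. $\mathfrak C$ is the $m^3$-dimensional $F$-vector space of cubic matrices $A=(a_{ijk})_{i,j,k=1}^m$ with entries in $F$ (entrywise addition and scalar multiplication), with standard basis $E_{ijk}$, $i,j,k\in I$ (the $(i,j,k)$ entry of $E_{ijk}$ is $1$ and all others are $0$). For $a\in\mathcal O_m$, the multiplication $*_a$ on $\mathfrak C$ is the bilinear extension of $$E_{ijk}*_aE_{lnr}=\delta_{kl}\,E_{i\,a(j,n)\,r},$$ where $\delta_{kl}$ is the Kronecker symbol. $\mathfrak C_a=(\mathfrak C,*_a)$ is the resulting algebra of cubic matrices (ACM). *)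

theory Defs
  imports "HOL-Analysis.Analysis"
begin

text \<open>
  The index set \<open>I = {1, ..., m}\<close> is rendered by \<open>UNIV\<close> of an arbitrary finite (hence nonempty)
  type \<open>'n\<close>, with \<open>m = CARD('n) \<ge> 1\<close>.
\<close>

definition assoc_ops :: "('n::finite \<Rightarrow> 'n \<Rightarrow> 'n) set" where
  "assoc_ops = {a. \<forall>i j k. a (a i j) k = a i (a j k)}"

definition perm_act :: "('n::finite \<Rightarrow> 'n) \<Rightarrow> ('n \<Rightarrow> 'n \<Rightarrow> 'n) \<Rightarrow> 'n \<Rightarrow> 'n \<Rightarrow> 'n" where
  "perm_act p a i j = p (a (inv p i) (inv p j))"

definition op_orbit :: "('n::finite \<Rightarrow> 'n \<Rightarrow> 'n) \<Rightarrow> ('n \<Rightarrow> 'n \<Rightarrow> 'n) set" where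
  "op_orbit c = {perm_act p c |p. p permutes UNIV}"

definition op_equiv :: "('n::finite \<Rightarrow> 'n \<Rightarrow> 'n) \<Rightarrow> ('n \<Rightarrow> 'n \<Rightarrow> 'n) \<Rightarrow> bool" where
  "op_equiv a b \<longleftrightarrow> (\<exists>c\<in>assoc_ops. a \<in> op_orbit c \<and> b \<in> op_orbit c)"

lemma perm_act_assoc_ops:
  assumes "p permutes UNIV" and "a \<in> assoc_ops"
  shows "perm_act p a \<in> assoc_ops"
  using assms by (auto simp: assoc_ops_def perm_act_def permutes_inverses)

lemma perm_act_id: "perm_act id a = a"
  by (simp add: perm_act_def fun_eq_iff)

lemma perm_act_comp:
  assumes "p permutes UNIV" and "q permutes UNIV"
  shows "perm_act (p \<circ> q) a = perm_act p (perm_act q a)"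
  using assms by (simp add: perm_act_def fun_eq_iff o_inv_distrib permutes_bij)

lemma op_equiv_iff:
  assumes "a \<in> assoc_ops" and "b \<in> assoc_ops"
  shows "op_equiv a b \<longleftrightarrow>
    (\<exists>p. p permutes UNIV \<and> (\<forall>j n. a j n = inv p (b (p j) (p n))))"
proof
  assume "op_equiv a b"
  then obtain c q r where q: "q permutes UNIV" "a = perm_act q c"
    and r: "r permutes UNIV" "b = perm_act r c"
    by (auto simp: op_equiv_def op_orbit_def)
  let ?p = "r \<circ> inv q"
  have p: "?p permutes UNIV"
    using q r by (intro permutes_compose permutes_inv)
  have "inv ?p = q \<circ> inv r"
    using o_inv_distrib[OF permutes_bij[OF r(1)] permutes_bij[OF permutes_inv[OF q(1)]]]
    by (simp add: permutes_inv_inv[OF q(1)])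
  then have "a j n = inv ?p (b (?p j) (?p n))" for j n
    using q r by (simp add: perm_act_def permutes_inverses)
  with p show "\<exists>p. p permutes UNIV \<and> (\<forall>j n. a j n = inv p (b (p j) (p n)))"
    by blast
next
  assume "\<exists>p. p permutes UNIV \<and> (\<forall>j n. a j n = inv p (b (p j) (p n)))"
  then obtain p where p: "p permutes UNIV" "\<And>j n. a j n = inv p (b (p j) (p n))"
    by blast
  have "b = perm_act p a"
    using p by (simp add: perm_act_def fun_eq_iff permutes_inverses)
  moreover have "a = perm_act id a"
    by (simp add: perm_act_id)
  ultimately show "op_equiv a b"
    using assms(1) p(1) permutes_id unfolding op_equiv_def op_orbit_def by blast
qed

text \<open>
  Homomorphisms of algebras over a field; an algebra is given by its scalar multiplication and
  its product. \<open>Vector_Spaces.linear\<close> includes that both scalar multiplications define vector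
  spaces.
\<close>

definition algebra_hom ::
  "('f::field \<Rightarrow> 'v::ab_group_add \<Rightarrow> 'v) \<Rightarrow> ('v \<Rightarrow> 'v \<Rightarrow> 'v) \<Rightarrow>
   ('f \<Rightarrow> 'w::ab_group_add \<Rightarrow> 'w) \<Rightarrow> ('w \<Rightarrow> 'w \<Rightarrow> 'w) \<Rightarrow> ('v \<Rightarrow> 'w) \<Rightarrow> bool" where
  "algebra_hom s1 m1 s2 m2 f \<longleftrightarrow>
     Vector_Spaces.linear s1 s2 f \<and> (\<forall>x y. f (m1 x y) = m2 (f x) (f y))"

definition algebra_isomorphic ::
  "('f::field \<Rightarrow> 'v::ab_group_add \<Rightarrow> 'v) \<Rightarrow> ('v \<Rightarrow> 'v \<Rightarrow> 'v) \<Rightarrow>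
   ('f \<Rightarrow> 'w::ab_group_add \<Rightarrow> 'w) \<Rightarrow> ('w \<Rightarrow> 'w \<Rightarrow> 'w) \<Rightarrow> bool" where
  "algebra_isomorphic s1 m1 s2 m2 \<longleftrightarrow> (\<exists>f. algebra_hom s1 m1 s2 m2 f \<and> bij f)"

text \<open>
  Indexing by triples, rather than nesting three vector types, makes the library's \<open>+\<close> and
  \<open>*s\<close> the entrywise operations.
\<close>

type_synonym ('f, 'n) cubic = "'f ^ ('n \<times> 'n \<times> 'n)"

definition cubic_unit :: "'n::finite \<Rightarrow> 'n \<Rightarrow> 'n \<Rightarrow> ('f::field, 'n) cubic" where
  "cubic_unit i j k = axis (i, j, k) 1"

definition unit_mult ::
  "('n::finite \<Rightarrow> 'n \<Rightarrow> 'n) \<Rightarrow> 'n \<times> 'n \<times> 'n \<Rightarrow> 'n \<times> 'n \<times> 'n \<Rightarrow> ('f::field, 'n) cubic" where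
  "unit_mult a = (\<lambda>(i, j, k) (l, n, r). if k = l then cubic_unit i (a j n) r else 0)"

definition acm_mult ::
  "('n::finite \<Rightarrow> 'n \<Rightarrow> 'n) \<Rightarrow> ('f::field, 'n) cubic \<Rightarrow> ('f, 'n) cubic \<Rightarrow> ('f, 'n) cubic" where
  "acm_mult a A B = (\<Sum>s\<in>UNIV. \<Sum>t\<in>UNIV. (A $ s * B $ t) *s unit_mult a s t)"

lemma acm_mult_unit:
  "acm_mult a (cubic_unit i j k) (cubic_unit l n r) =
     (if k = l then cubic_unit i (a j n) r else 0 :: ('f::field, 'n::finite) cubic)"
proof -
  have "acm_mult a (cubic_unit i j k) (cubic_unit l n r) =
     (\<Sum>s\<in>UNIV. \<Sum>t\<in>UNIV. if t = (l, n, r) then (if s = (i, j, k) then unit_mult a s t else 0)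
        else (0 :: ('f, 'n) cubic))"
    unfolding acm_mult_def
    by (intro sum.cong refl) (auto simp: cubic_unit_def axis_def)
  also have "\<dots> = unit_mult a (i, j, k) (l, n, r)"
    by (simp add: sum.delta)
  finally show ?thesis
    by (simp add: unit_mult_def)
qed

lemma acm_mult_linear_right:
  "Vector_Spaces.linear (*s) (*s) (acm_mult a A :: ('f::field, 'n::finite) cubic \<Rightarrow> _)"
  by (intro Vector_Spaces.linear.intro module_hom.intro module_hom_axioms.intro)
    (auto simp: acm_mult_def vec.vector_space_axioms vec.module_axioms vec.scale_sum_right
      vec.scale_left_distrib distrib_left sum.distrib mult_ac)

lemma acm_mult_linear_left:
  "Vector_Spaces.linear (*s) (*s) (\<lambda>A. acm_mult a A B :: ('f::field, 'n::finite) cubic)"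
  by (intro Vector_Spaces.linear.intro module_hom.intro module_hom_axioms.intro)
    (auto simp: acm_mult_def vec.vector_space_axioms vec.module_axioms vec.scale_sum_right
      vec.scale_left_distrib distrib_left sum.distrib mult_ac)

end

theory Submission
  imports Defs
begin

text \<open>
  If \<open>a \<sim> b\<close>, then some permutation \<open>p\<close> of the index set satisfies \<open>p (a j n) = b (p j) (p n)\<close>.
  In a product of two basis matrices the operation combines only the middle indices, while the
  outer ones are matched by the Kronecker symbol. Applying \<open>p\<close> to the middle index and leaving
  the outer indices alone therefore sends the structure constants of \<open>\<CC>\<^sub>a\<close> to those of \<open>\<CC>\<^sub>b\<close>
  (\<open>relabel_middle_unit_mult\<close>). The linear extension of this permutation of the standard basis is
  bijective, and it is multiplicative because both products are bilinear extensions of the products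
  of basis matrices (\<open>relabel_middle_acm_mult\<close>).
\<close>

definition map_middle :: "('n \<Rightarrow> 'n) \<Rightarrow> 'n \<times> 'n \<times> 'n \<Rightarrow> 'n \<times> 'n \<times> 'n" where
  "map_middle p = (\<lambda>(i, j, k). (i, p j, k))"

text \<open>
  Moving the basis matrix at position \<open>s\<close> to \<open>map_middle p s\<close> means reading the entries of the
  argument along the inverse of \<open>map_middle p\<close>.
\<close>

definition relabel_middle :: "('n::finite \<Rightarrow> 'n) \<Rightarrow> ('f::field, 'n) cubic \<Rightarrow> ('f, 'n) cubic" where
  "relabel_middle p A = (\<chi> s. A $ map_middle (inv p) s)"

lemma map_middle_inv:
  assumes "bij p"
  shows "map_middle p (map_middle (inv p) s) = s" and "map_middle (inv p) (map_middle p s) = s"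
  using assms
  by (auto simp: map_middle_def bij_is_surj surj_f_inv_f bij_is_inj inv_f_f split: prod.split)

lemma bij_map_middle:
  assumes "bij p"
  shows "bij (map_middle p)"
  by (rule o_bij[of "map_middle (inv p)"]) (simp_all add: fun_eq_iff map_middle_inv[OF assms])

lemma relabel_middle_unit:
  assumes "bij p"
  shows "relabel_middle p (cubic_unit i j k) = cubic_unit i (p j) k"
proof -
  have "inv p x = j \<longleftrightarrow> x = p j" for x
    using assms by (metis bij_inv_eq_iff)
  then show ?thesis
    by (auto simp: relabel_middle_def cubic_unit_def axis_def map_middle_def vec_eq_iff)
qed

lemma linear_relabel_middle:
  "Vector_Spaces.linear (*s) (*s) (relabel_middle p :: ('f::field, 'n::finite) cubic \<Rightarrow> _)"
  by (intro Vector_Spaces.linear.intro module_hom.intro module_hom_axioms.intro)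
    (auto simp: relabel_middle_def vec_eq_iff vec.vector_space_axioms vec.module_axioms)

lemma bij_relabel_middle:
  assumes "bij p"
  shows "bij (relabel_middle p :: ('f::field, 'n::finite) cubic \<Rightarrow> _)"
  by (rule o_bij[of "relabel_middle (inv p)"])
    (simp_all add: fun_eq_iff vec_eq_iff relabel_middle_def inv_inv_eq[OF assms]
      map_middle_inv[OF assms])

text \<open>
  The outer indices are untouched, so the Kronecker symbol vanishes on both sides at once; on the
  middle index the claim is exactly the homomorphism property of \<open>p\<close>.
\<close>

lemma relabel_middle_unit_mult:
  fixes a b :: "'n::finite \<Rightarrow> 'n \<Rightarrow> 'n"
  assumes "bij p" and "\<And>j n. p (a j n) = b (p j) (p n)"
  shows "relabel_middle p (unit_mult a s t) =
    (unit_mult b (map_middle p s) (map_middle p t) :: ('f::field, 'n) cubic)"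
proof -
  have "relabel_middle p 0 = (0 :: ('f, 'n) cubic)"
    by (simp add: relabel_middle_def vec_eq_iff)
  then show ?thesis
    by (auto simp: unit_mult_def map_middle_def relabel_middle_unit assms split: prod.split)
qed

lemma relabel_middle_acm_mult:
  fixes a b :: "'n::finite \<Rightarrow> 'n \<Rightarrow> 'n" and A B :: "('f::field, 'n) cubic"
  assumes "bij p" and "\<And>j n. p (a j n) = b (p j) (p n)"
  shows "relabel_middle p (acm_mult a A B) =
    acm_mult b (relabel_middle p A) (relabel_middle p B)"
proof -
  interpret Vector_Spaces.linear "(*s)" "(*s)" "relabel_middle p :: ('f, 'n) cubic \<Rightarrow> _"
    by (rule linear_relabel_middle)
  let ?g = "map_middle p"
  let ?A = "relabel_middle p A" and ?B = "relabel_middle p B"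
  have entry: "relabel_middle p C $ ?g s = C $ s" for C :: "('f, 'n) cubic" and s
    by (simp add: relabel_middle_def map_middle_inv[OF assms(1)])
  have reindex: "(\<Sum>s\<in>UNIV. h (?g s)) = sum h UNIV" for h :: "_ \<Rightarrow> ('f, 'n) cubic"
    by (rule sum.reindex_bij_betw[OF bij_map_middle[OF assms(1)]])
  have "relabel_middle p (acm_mult a A B) =
    (\<Sum>s\<in>UNIV. \<Sum>t\<in>UNIV. (A $ s * B $ t) *s unit_mult b (?g s) (?g t))"
    by (simp only: acm_mult_def sum scale relabel_middle_unit_mult[where a = a and b = b, OF assms])
  also have "\<dots> = (\<Sum>s\<in>UNIV. \<Sum>t\<in>UNIV. (?A $ ?g s * ?B $ ?g t) *s unit_mult b (?g s) (?g t))"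
    by (simp only: entry)
  also have "\<dots> = (\<Sum>s\<in>UNIV. \<Sum>t\<in>UNIV. (?A $ ?g s * ?B $ t) *s unit_mult b (?g s) t)"
  proof (rule sum.cong[OF refl])
    fix s :: "'n \<times> 'n \<times> 'n"
    show "(\<Sum>t\<in>UNIV. (?A $ ?g s * ?B $ ?g t) *s unit_mult b (?g s) (?g t)) =
        (\<Sum>t\<in>UNIV. (?A $ ?g s * ?B $ t) *s unit_mult b (?g s) t)"
      by (rule reindex[where h = "\<lambda>t. (?A $ ?g s * ?B $ t) *s unit_mult b (?g s) t"])
  qed
  also have "\<dots> = (\<Sum>s\<in>UNIV. \<Sum>t\<in>UNIV. (?A $ s * ?B $ t) *s unit_mult b s t)"
    by (rule reindex[where h = "\<lambda>s. \<Sum>t\<in>UNIV. (?A $ s * ?B $ t) *s unit_mult b s t"])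
  finally show ?thesis
    by (simp only: acm_mult_def)
qed

theorem theorem3p2:
  fixes a b :: "'n::finite \<Rightarrow> 'n \<Rightarrow> 'n"
  assumes "a \<in> assoc_ops" and "b \<in> assoc_ops" and "op_equiv a b"
  shows "algebra_isomorphic
    (*s) (acm_mult a :: ('f::field, 'n) cubic \<Rightarrow> ('f, 'n) cubic \<Rightarrow> ('f, 'n) cubic)
    (*s) (acm_mult b :: ('f, 'n) cubic \<Rightarrow> ('f, 'n) cubic \<Rightarrow> ('f, 'n) cubic)"
proof -
  obtain p where p: "p permutes UNIV" and conjugate: "\<And>j n. a j n = inv p (b (p j) (p n))"
    using assms op_equiv_iff by blast
  have "bij p"
    using p by (rule permutes_bij)
  moreover have "p (a j n) = b (p j) (p n)" for j n
    by (simp add: conjugate permutes_inverses[OF p])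
  ultimately show ?thesis
    unfolding algebra_isomorphic_def algebra_hom_def
    by (intro exI[of _ "relabel_middle p"] conjI allI
        linear_relabel_middle relabel_middle_acm_mult bij_relabel_middle)
qed

end
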